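(* If $G$ is an interval graph, then $H_G=\overline{A_G}$, the complement of the oriented star-conflict graph of $G$, is a comparability graph.
   Context: All graphs are finite, simple and undirected. A graph $G$ is an interval graph if one can assign to each vertex a closed real interval such that two distinct vertices are adjacent precisely when their intervals intersect. An orientation of a graph is transitive if $x\to y$ and $y\to z$ imply that $xz$ is an edge oriented as $x\to z$. A graph is a comparability graph if it admits a transitive orientation. The oriented star-conflict graph $A_G$ has vertex set $V(A_G)=\{(c,\ell): c\ell\in E(G)\}$, the set of ordered edges of $G$ (each edge gives two ordered edges). Two distinct ordered edges $(c,\ell)$ and $(d,r)$ are compatible if either (same centre) $c=d$, $\ell\ne r$ and $\ell r\notin E(G)$; or (different centres) $c\neq d$, the four vertices $c,\ell,d,r$ are distinct, and $cd,cr,\ell d,\ell r\notin E(G)$. Two distinct vertices of $A_G$ are adjacent if and only if the corresponding ordered edges are not compatible; thus two distinct vertices of $H_G=\overline{A_G}$ are adjacent if and only if they are compatible. *)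

theory Defs
  imports Complex_Main "Graph_Theory.Pair_Digraph"
begin

text \<open>
  Finite simple undirected graphs are given by the locale predicate \<^const>\<open>pair_graph\<close>: an edge
  \<open>uv\<close> is the pair of arcs \<open>(u, v)\<close>, \<open>(v, u)\<close>, so \<open>parcs G\<close> is also the set of ordered edges.
\<close>

definition interval_graph :: "'a pair_pre_digraph \<Rightarrow> bool" where
  "interval_graph G \<longleftrightarrow> pair_graph G \<and>
    (\<exists>a b :: 'a \<Rightarrow> real.
      (\<forall>v \<in> pverts G. a v \<le> b v) \<and>
      (\<forall>u \<in> pverts G. \<forall>v \<in> pverts G. u \<noteq> v \<longrightarrow>
        ((u, v) \<in> parcs G \<longleftrightarrow> {a u..b u} \<inter> {a v..b v} \<noteq> {})))"

definition is_orientation :: "'a pair_pre_digraph \<Rightarrow> 'a rel \<Rightarrow> bool" where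
  "is_orientation G D \<longleftrightarrow> D \<subseteq> parcs G \<and>
    (\<forall>u v. (u, v) \<in> parcs G \<longrightarrow> ((u, v) \<in> D \<longleftrightarrow> (v, u) \<notin> D))"

text \<open>As \<open>D \<subseteq> parcs G\<close>, transitivity of \<open>D\<close> includes that \<open>xz\<close> is an edge whenever
  \<open>x \<rightarrow> y \<rightarrow> z\<close>.\<close>

definition comparability_graph :: "'a pair_pre_digraph \<Rightarrow> bool" where
  "comparability_graph G \<longleftrightarrow> pair_graph G \<and> (\<exists>D. is_orientation G D \<and> trans D)"

definition complement_graph :: "'a pair_pre_digraph \<Rightarrow> 'a pair_pre_digraph" where
  "complement_graph G = \<lparr> pverts = pverts G,
     parcs = {(u, v). u \<in> pverts G \<and> v \<in> pverts G \<and> u \<noteq> v \<and> (u, v) \<notin> parcs G} \<rparr>"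

fun compatible :: "'a pair_pre_digraph \<Rightarrow> 'a \<times> 'a \<Rightarrow> 'a \<times> 'a \<Rightarrow> bool" where
  "compatible G (c, l) (d, r) \<longleftrightarrow>
     (c = d \<and> l \<noteq> r \<and> (l, r) \<notin> parcs G) \<or>
     (c \<noteq> d \<and> distinct [c, l, d, r] \<and>
      (c, d) \<notin> parcs G \<and> (c, r) \<notin> parcs G \<and> (l, d) \<notin> parcs G \<and> (l, r) \<notin> parcs G)"

definition star_conflict_graph :: "'a pair_pre_digraph \<Rightarrow> ('a \<times> 'a) pair_pre_digraph" where
  "star_conflict_graph G = \<lparr> pverts = parcs G,
     parcs = {(e, f). e \<in> parcs G \<and> f \<in> parcs G \<and> e \<noteq> f \<and> \<not> compatible G e f} \<rparr>"

lemma compatible_sym: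
  assumes "pair_graph G" "compatible G e f"
  shows "compatible G f e"
proof -
  interpret pair_graph G by fact
  show ?thesis
    using assms(2) by (cases e; cases f) (auto dest: arcs_symmetric)
qed

lemma pair_graph_star_conflict_graph:
  assumes "pair_graph G"
  shows "pair_graph (star_conflict_graph G)"
proof -
  interpret pair_graph G by fact
  have "finite (parcs (star_conflict_graph G))"
    by (rule finite_subset[of _ "parcs G \<times> parcs G"])
      (use pair_finite_arcs in \<open>auto simp: star_conflict_graph_def\<close>)
  moreover have "sym (parcs (star_conflict_graph G))"
    using compatible_sym[OF assms] by (auto simp: star_conflict_graph_def intro!: symI)
  ultimately show ?thesis
    by unfold_locales
      (use pair_finite_arcs in \<open>auto simp: star_conflict_graph_def symmetric_def\<close>)
qed

lemma pair_graph_complement_graph: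
  assumes "pair_graph G"
  shows "pair_graph (complement_graph G)"
proof -
  interpret pair_graph G by fact
  have "finite (parcs (complement_graph G))"
    by (rule finite_subset[of _ "pverts G \<times> pverts G"])
      (use pair_finite_verts in \<open>auto simp: complement_graph_def\<close>)
  moreover have "sym (parcs (complement_graph G))"
    by (auto simp: complement_graph_def intro!: symI dest: arcs_symmetric)
  ultimately show ?thesis
    by unfold_locales
      (use pair_finite_verts in \<open>auto simp: complement_graph_def symmetric_def\<close>)
qed

lemma parcs_complement_star_conflict_graph:
  "(e, f) \<in> parcs (complement_graph (star_conflict_graph G)) \<longleftrightarrow>
     e \<in> parcs G \<and> f \<in> parcs G \<and> e \<noteq> f \<and> compatible G e f"
  by (auto simp: complement_graph_def star_conflict_graph_def)

end

theory Submission
  imports Defs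
begin

text \<open>
  Orient a compatible pair from \<open>(c, l)\<close> to \<open>(d, r)\<close> when the interval of \<open>l\<close> lies to the left of
  that of \<open>r\<close>. If the centres differ, then, the intervals of \<open>c\<close> and \<open>l\<close> having connected union, both
  lie to the left of the intervals of \<open>d\<close> and \<open>r\<close>; hence the orientation is transitive.
\<close>

locale interval_model = pair_graph G
  for G :: "'a pair_pre_digraph" +
  fixes a b :: "'a \<Rightarrow> real"
  assumes bounds: "v \<in> pverts G \<Longrightarrow> a v \<le> b v"
    and arc_iff: "\<lbrakk>u \<in> pverts G; v \<in> pverts G; u \<noteq> v\<rbrakk> \<Longrightarrow>
      (u, v) \<in> parcs G \<longleftrightarrow> {a u..b u} \<inter> {a v..b v} \<noteq> {}"
begin

text \<open>Since neither interval is empty, they meet iff each starts no later than the other ends.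
  This turns adjacency into linear inequalities.\<close>

lemma arc_iff_le:
  assumes "u \<in> pverts G" "v \<in> pverts G" "u \<noteq> v"
  shows "(u, v) \<in> parcs G \<longleftrightarrow> a u \<le> b v \<and> a v \<le> b u"
  using bounds[OF assms(1)] bounds[OF assms(2)] by (auto simp: arc_iff[OF assms])

lemma arcD:
  assumes "(u, v) \<in> parcs G"
  shows "u \<in> pverts G" "v \<in> pverts G" "u \<noteq> v" "a u \<le> b v" "a v \<le> b u"
proof -
  show *: "u \<in> pverts G" "v \<in> pverts G" "u \<noteq> v"
    using in_arcsD1[OF assms] in_arcsD2[OF assms] no_loops[of "(u, v)"] assms by auto
  show "a u \<le> b v" "a v \<le> b u"
    using arc_iff_le[OF *] assms by auto
qed

lemma left_of_imp_non_adjacent: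
  assumes "u \<in> pverts G" "v \<in> pverts G" "b u < a v"
  shows "u \<noteq> v" "(u, v) \<notin> parcs G"
  using assms bounds[of v] arcD(5)[of u v] by auto

text \<open>For distinct centres, non-adjacency only says that two intervals are disjoint; the order
  of the leaves settles on which side each lies, because \<open>c\<close> meets \<open>l\<close> and
  \<open>d\<close> meets \<open>r\<close>.\<close>

lemma compatible_iff_left_of:
  assumes cl: "(c, l) \<in> parcs G" and dr: "(d, r) \<in> parcs G" and lr: "b l < a r"
  shows "compatible G (c, l) (d, r) \<longleftrightarrow> c = d \<or> b c < a d \<and> b c < a r \<and> b l < a d"
proof
  assume *: "compatible G (c, l) (d, r)"
  show "c = d \<or> b c < a d \<and> b c < a r \<and> b l < a d"
  proof (cases "c = d")
    case False
    then have "b c < a d \<or> b d < a c" "b c < a r \<or> b r < a c" "b l < a d \<or> b d < a l"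
      using * arcD(1,2)[OF cl] arcD(1,2)[OF dr]
        arc_iff_le[of c d] arc_iff_le[of c r] arc_iff_le[of l d] by auto
    \<comment> \<open>Every wrong side closes a cycle: \<open>b d < a l\<close> and
      \<open>b d < a c\<close> both give \<open>a r \<le> b d < b l\<close>, and
      \<open>b r < a c\<close> gives \<open>b r < b l\<close>, against
      \<open>b l < a r\<close>.\<close>
    then show ?thesis
      using lr arcD[OF cl] arcD[OF dr] bounds[of l] bounds[of r] by linarith
  qed simp
next
  assume *: "c = d \<or> b c < a d \<and> b c < a r \<and> b l < a d"
  note verts = arcD(1-3)[OF cl] arcD(1-3)[OF dr]
  have lr': "l \<noteq> r" "(l, r) \<notin> parcs G"
    using left_of_imp_non_adjacent lr verts by blast+
  show "compatible G (c, l) (d, r)"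
  proof (cases "c = d")
    case False
    then have "b c < a d" "b c < a r" "b l < a d"
      using * by auto
    then show ?thesis
      using False verts lr' left_of_imp_non_adjacent[of c d] left_of_imp_non_adjacent[of c r]
        left_of_imp_non_adjacent[of l d] by auto
  qed (use lr' in auto)
qed

text \<open>Comparing leaves rather than centres gives a direction also when the centres
  coincide.\<close>

definition leaf_orientation :: "('a \<times> 'a) rel" where
  "leaf_orientation = {(e, f). e \<in> parcs G \<and> f \<in> parcs G \<and> compatible G e f \<and> b (snd e) < a (snd f)}"

lemma leaf_orientation_iff:
  "((c, l), (d, r)) \<in> leaf_orientation \<longleftrightarrow> (c, l) \<in> parcs G \<and> (d, r) \<in> parcs G \<and> b l < a r \<and>
     (c = d \<or> b c < a d \<and> b c < a r \<and> b l < a d)"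
  unfolding leaf_orientation_def using compatible_iff_left_of by auto

lemma trans_leaf_orientation: "trans leaf_orientation"
proof (rule transI)
  fix e f g
  assume "(e, f) \<in> leaf_orientation" "(f, g) \<in> leaf_orientation"
  moreover obtain c l d r x s where "e = (c, l)" "f = (d, r)" "g = (x, s)"
    by (cases e, cases f, cases g)
  \<comment> \<open>The intervals of the middle pair are nonempty, so strict inequalities chain
    through \<open>d\<close> if both steps change the centre, and through \<open>r\<close> if a step
    keeps it.\<close>
  moreover have "a d \<le> b d" "a r \<le> b r" if "(d, r) \<in> parcs G"
    using arcD[OF that] bounds by auto
  ultimately show "(e, g) \<in> leaf_orientation"
    by (auto simp: leaf_orientation_iff)
qed

text \<open>Both kinds of compatibility make the leaves distinct and non-adjacent, so their
  intervals are disjoint and exactly one of them lies to the left.\<close>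

lemma is_orientation_leaf_orientation:
  "is_orientation (complement_graph (star_conflict_graph G)) leaf_orientation"
  unfolding is_orientation_def
proof (intro conjI allI impI)
  show "leaf_orientation \<subseteq> parcs (complement_graph (star_conflict_graph G))"
  proof (rule subrelI)
    fix e f
    assume "(e, f) \<in> leaf_orientation"
    then have *: "e \<in> parcs G" "f \<in> parcs G" "compatible G e f" "b (snd e) < a (snd f)"
      by (auto simp: leaf_orientation_def)
    \<comment> \<open>This rules out \<open>e = f\<close>, as no nonempty interval lies to the left
      of itself.\<close>
    have "a (snd e) \<le> b (snd e)"
      using *(1) bounds arcD(2)[of "fst e" "snd e"] by simp
    with * show "(e, f) \<in> parcs (complement_graph (star_conflict_graph G))"
      by (auto simp: parcs_complement_star_conflict_graph)
  qed
next
  fix e f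
  assume "(e, f) \<in> parcs (complement_graph (star_conflict_graph G))"
  then have ef: "e \<in> parcs G" "f \<in> parcs G" "compatible G e f"
    by (auto simp: parcs_complement_star_conflict_graph)
  then have fe: "compatible G f e"
    using compatible_sym pair_graph_axioms by blast
  obtain c l d r where eq: "e = (c, l)" "f = (d, r)"
    by (cases e, cases f)
  then have verts: "l \<in> pverts G" "r \<in> pverts G"
    using ef arcD(2) by auto
  have "l \<noteq> r" "(l, r) \<notin> parcs G"
    using ef eq by auto
  then have "b l < a r \<longleftrightarrow> \<not> b r < a l"
    using arc_iff_le[OF verts] bounds[OF verts(1)] bounds[OF verts(2)] by auto
  then show "(e, f) \<in> leaf_orientation \<longleftrightarrow> (f, e) \<notin> leaf_orientation"
    using ef fe eq by (simp add: leaf_orientation_def)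
qed

end

theorem corollary8:
  fixes G :: "'a pair_pre_digraph"
  assumes "interval_graph G"
  shows "comparability_graph (complement_graph (star_conflict_graph G))"
proof -
  from assms obtain a b :: "'a \<Rightarrow> real" where "pair_graph G"
    and "\<forall>v \<in> pverts G. a v \<le> b v"
    and "\<forall>u \<in> pverts G. \<forall>v \<in> pverts G. u \<noteq> v \<longrightarrow>
      ((u, v) \<in> parcs G \<longleftrightarrow> {a u..b u} \<inter> {a v..b v} \<noteq> {})"
    unfolding interval_graph_def by blast
  then interpret interval_model G a b
    unfolding interval_model_def interval_model_axioms_def by blast
  show ?thesis
    unfolding comparability_graph_def
    using pair_graph_complement_graph[OF pair_graph_star_conflict_graph[OF pair_graph_axioms]]
      is_orientation_leaf_orientation trans_leaf_orientation by blast
qed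

end
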